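(* Let $G=(V,E)$ be a finite, simple, connected AT-free graph. For every admissible vertex $s$ of $G$ there is a linear vertex ordering $\tau$ of $V$ beginning in $s$ that is both an AT-free order and a monotone dominating pair order of $G$.
   Context: An asteroidal triple of $G$ is an independent set of three vertices such that for any two of them there is a path between them containing no neighbour of the third; $G$ is AT-free if it has none. A path $P$ avoids a vertex $v$ if $v$ has no neighbour on $P$. The domination betweenness $\mathcal{B}_D(G)$ is the set of triples $(x,y,z)$ of distinct vertices such that there is a chordless $x$-$y$-path avoiding $z$ and a chordless $y$-$z$-path avoiding $x$. A vertex $y$ is admissible if there are no $x,z$ with $(x,y,z)\in\mathcal{B}_D(G)$. An AT-free order is an ordering $\tau$ of $V$ such that for every $(x,y,z)\in\mathcal{B}_D(G)$ we have $y\prec_\tau x$ or $y\prec_\tau z$. Two vertices $a,b$ form a dominating pair of a graph $H$ if the vertex set of every $a$-$b$-path in $H$ is a dominating set of $H$. An ordering $\tau=(v_1,\ldots,v_n)$ is a monotone dominating pair order if for every $i\in\{1,\ldots,n\}$ the vertices $v_1$ and $v_i$ form a dominating pair of the induced subgraph $G[\{v_1,\ldots,v_i\}]$. *)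

theory Defs
  imports "Graph_Theory.Graph_Theory"
begin

text \<open>
  Finite simple graphs are the locale \<^locale>\<open>graph\<close>: finite symmetric digraphs without loops and
  parallel arcs, so that each undirected edge is a pair of opposite arcs. All notions below are
  meant for symmetric digraphs, where the orientation in \<open>u \<rightarrow>\<^bsub>G\<^esub> v\<close> is immaterial.
\<close>

definition path_betw :: "('a,'b) pre_digraph \<Rightarrow> 'a \<Rightarrow> 'a list \<Rightarrow> 'a \<Rightarrow> bool" where
  "path_betw G x p y \<longleftrightarrow> vpath p G \<and> hd p = x \<and> last p = y"

definition chordless :: "('a,'b) pre_digraph \<Rightarrow> 'a list \<Rightarrow> bool" where
  "chordless G p \<longleftrightarrow> (\<forall>i j. Suc i < j \<and> j < length p \<longrightarrow> \<not> (p ! i) \<rightarrow>\<^bsub>G\<^esub> (p ! j))"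

definition avoids :: "('a,'b) pre_digraph \<Rightarrow> 'a list \<Rightarrow> 'a \<Rightarrow> bool" where
  "avoids G p v \<longleftrightarrow> (\<forall>u \<in> set p. \<not> v \<rightarrow>\<^bsub>G\<^esub> u)"

definition independent_set :: "('a,'b) pre_digraph \<Rightarrow> 'a set \<Rightarrow> bool" where
  "independent_set G S \<longleftrightarrow> S \<subseteq> verts G \<and> (\<forall>u \<in> S. \<forall>v \<in> S. \<not> u \<rightarrow>\<^bsub>G\<^esub> v)"

definition asteroidal_triple :: "('a,'b) pre_digraph \<Rightarrow> 'a set \<Rightarrow> bool" where
  "asteroidal_triple G T \<longleftrightarrow> independent_set G T \<and> card T = 3 \<and>
     (\<forall>a \<in> T. \<forall>b \<in> T. \<forall>c \<in> T. a \<noteq> b \<and> a \<noteq> c \<and> b \<noteq> c \<longrightarrow>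
        (\<exists>p. path_betw G a p b \<and> avoids G p c))"

definition AT_free :: "('a,'b) pre_digraph \<Rightarrow> bool" where
  "AT_free G \<longleftrightarrow> (\<nexists>T. asteroidal_triple G T)"

definition dom_betweenness :: "('a,'b) pre_digraph \<Rightarrow> ('a \<times> 'a \<times> 'a) set" where
  "dom_betweenness G = {(x, y, z). x \<in> verts G \<and> y \<in> verts G \<and> z \<in> verts G \<and>
     x \<noteq> y \<and> y \<noteq> z \<and> x \<noteq> z \<and>
     (\<exists>p. path_betw G x p y \<and> chordless G p \<and> avoids G p z) \<and>
     (\<exists>q. path_betw G y q z \<and> chordless G q \<and> avoids G q x)}"

definition admissible :: "('a,'b) pre_digraph \<Rightarrow> 'a \<Rightarrow> bool" where
  "admissible G y \<longleftrightarrow> y \<in> verts G \<and> (\<nexists>x z. (x, y, z) \<in> dom_betweenness G)"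

definition vertex_ordering :: "('a,'b) pre_digraph \<Rightarrow> 'a list \<Rightarrow> bool" where
  "vertex_ordering G \<tau> \<longleftrightarrow> distinct \<tau> \<and> set \<tau> = verts G"

definition precedes :: "'a list \<Rightarrow> 'a \<Rightarrow> 'a \<Rightarrow> bool" where
  "precedes \<tau> x y \<longleftrightarrow> (\<exists>i j. i < j \<and> j < length \<tau> \<and> \<tau> ! i = x \<and> \<tau> ! j = y)"

definition AT_free_order :: "('a,'b) pre_digraph \<Rightarrow> 'a list \<Rightarrow> bool" where
  "AT_free_order G \<tau> \<longleftrightarrow> vertex_ordering G \<tau> \<and>
     (\<forall>x y z. (x, y, z) \<in> dom_betweenness G \<longrightarrow> precedes \<tau> y x \<or> precedes \<tau> y z)"

definition dominating_set :: "('a,'b) pre_digraph \<Rightarrow> 'a set \<Rightarrow> bool" where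
  "dominating_set H D \<longleftrightarrow> D \<subseteq> verts H \<and> (\<forall>v \<in> verts H. v \<in> D \<or> (\<exists>u \<in> D. u \<rightarrow>\<^bsub>H\<^esub> v))"

definition dominating_pair :: "('a,'b) pre_digraph \<Rightarrow> 'a \<Rightarrow> 'a \<Rightarrow> bool" where
  "dominating_pair H a b \<longleftrightarrow> a \<in> verts H \<and> b \<in> verts H \<and>
     (\<forall>p. path_betw H a p b \<longrightarrow> dominating_set H (set p))"

text \<open>With 0-based positions, \<open>set (take (Suc i) \<tau>)\<close> is the prefix set ending in \<open>\<tau> ! i\<close>.\<close>

definition monotone_dominating_pair_order :: "('a,'b) pre_digraph \<Rightarrow> 'a list \<Rightarrow> bool" where
  "monotone_dominating_pair_order G \<tau> \<longleftrightarrow> vertex_ordering G \<tau> \<and>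
     (\<forall>i < length \<tau>. dominating_pair (G \<restriction> set (take (Suc i) \<tau>)) (\<tau> ! 0) (\<tau> ! i))"

end

theory Submission
  imports Defs
begin

text \<open>
  Write \<open>y < e\<close> if some path from \<open>s\<close> to \<open>y\<close> avoids \<open>e\<close>. Admissibility of \<open>s\<close> makes this a strict
  partial order on the vertices other than \<open>s\<close>, and nonadjacent incomparable vertices lie above the
  same vertices. Ranking each vertex by the number of vertices below it, AT-freeness implies: if \<open>y\<close>
  has maximum rank in a set \<open>D\<close> and lies between two vertices of \<open>D\<close>, then these have maximum rank,
  too. An ordering by rank is a monotone dominating pair order, since a vertex missed by a path from
  \<open>s\<close> to \<open>y\<close> has larger rank than \<open>y\<close>. It is an AT-free order as soon as the ties are broken
  suitably, which is possible if every nonempty vertex set \<open>M\<close> has a member that is not between two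
  others. The latter follows by induction on the graph: for an admissible vertex \<open>r\<close>, the paths that
  witness betweenness inside the top rank class of \<open>M\<close> with respect to \<open>r\<close> do not contain \<open>r\<close>, so
  \<open>r\<close> can be deleted.

  An admissible vertex exists: let \<open>K\<close> be a largest component among all graphs \<open>G - N[v]\<close>, and let
  \<open>A\<close> be the set of vertices outside \<open>K\<close> without neighbours in \<open>K\<close>. By maximality \<open>K\<close> is a component
  of \<open>G - N[a]\<close> for every \<open>a \<in> A\<close>, and therefore a vertex that is admissible in \<open>G[A]\<close> is admissible
  in \<open>G\<close>.
\<close>

section \<open>Betweenness in symmetric relations\<close>

locale symmetric_adjacency =
  fixes E :: "'a \<Rightarrow> 'a \<Rightarrow> bool"
  assumes sym: "E x y \<Longrightarrow> E y x"
begin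

text \<open>Reachability by walks inside \<open>U\<close>, endpoints included. Arguing with
  components of vertex sets postpones distinctness and chordlessness to the final translation into
  paths.\<close>

inductive conn :: "'a set \<Rightarrow> 'a \<Rightarrow> 'a \<Rightarrow> bool" for U where
  refl: "x \<in> U \<Longrightarrow> conn U x x"
| step: "conn U x y \<Longrightarrow> E y z \<Longrightarrow> z \<in> U \<Longrightarrow> conn U x z"

lemma conn_in: "conn U x y \<Longrightarrow> x \<in> U \<and> y \<in> U"
  by (induction rule: conn.induct) auto

lemma conn_trans: "conn U y z \<Longrightarrow> conn U x y \<Longrightarrow> conn U x z"
  by (induction rule: conn.induct) (auto intro: conn.intros)

lemma conn_sym: "conn U x y \<Longrightarrow> conn U y x"
proof (induction rule: conn.induct)
  case (step x y z)
  then have "conn U z y"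
    by (meson conn.intros conn_in sym)
  then show ?case
    using step.IH conn_trans by blast
qed (rule conn.refl)

lemma conn_mono: "conn U x y \<Longrightarrow> U \<subseteq> W \<Longrightarrow> conn W x y"
  by (induction rule: conn.induct) (auto intro: conn.intros)

lemma conn_closed:
  assumes "conn U x y" and "x \<in> W"
    and "\<And>b w. conn U x b \<Longrightarrow> b \<in> W \<Longrightarrow> E b w \<Longrightarrow> w \<in> U \<Longrightarrow> w \<in> W"
  shows "conn (U \<inter> W) x y"
  using assms
proof (induction rule: conn.induct)
  case (step x y z)
  have "conn (U \<inter> W) x y"
    by (rule step.IH) (use step.prems in blast)+
  then show ?case
    using step.hyps step.prems conn_in by (blast intro: conn.step)
qed (simp add: conn.refl)

lemma conn_component: "conn U x y \<Longrightarrow> conn {w. conn U x w} x y"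
  by (induction rule: conn.induct) (auto intro: conn.intros)

lemma conn_delete: "conn U x y \<Longrightarrow> \<not> conn U x r \<Longrightarrow> conn (U - {r}) x y"
  by (induction rule: conn.induct) (auto intro: conn.intros)

text \<open>The complement of the closed neighbourhood of \<open>z\<close>. Since \<open>z\<close>
  itself is excluded, \<open>conn_avoiding\<close> makes the avoided vertex distinct from and
  nonadjacent to both ends.\<close>

definition far :: "'a set \<Rightarrow> 'a \<Rightarrow> 'a set" where
  "far V z = {v \<in> V. v \<noteq> z \<and> \<not> E z v}"

text \<open>The avoided vertex comes first, so the relation \<open>y < e\<close> of the overview is
  \<open>conn_avoiding V e s y\<close>.\<close>

definition conn_avoiding :: "'a set \<Rightarrow> 'a \<Rightarrow> 'a \<Rightarrow> 'a \<Rightarrow> bool" where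
  "conn_avoiding V z x y \<longleftrightarrow> z \<in> V \<and> conn (far V z) x y"

definition between :: "'a set \<Rightarrow> 'a \<Rightarrow> 'a \<Rightarrow> 'a \<Rightarrow> bool" where
  "between V x y z \<longleftrightarrow> conn_avoiding V z x y \<and> conn_avoiding V x y z"

definition no_AT :: "'a set \<Rightarrow> bool" where
  "no_AT V \<longleftrightarrow> (\<forall>x y z. between V x y z \<longrightarrow> \<not> conn_avoiding V y x z)"

lemma far_mono: "U \<subseteq> V \<Longrightarrow> far U z \<subseteq> far V z"
  by (auto simp: far_def)

lemma far_sym: "v \<in> far V z \<Longrightarrow> z \<in> V \<Longrightarrow> z \<in> far V v"
  using sym by (auto simp: far_def)

lemma conn_avoiding_mono: "conn_avoiding U z x y \<Longrightarrow> U \<subseteq> V \<Longrightarrow> conn_avoiding V z x y"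
  using conn_mono far_mono by (auto simp: conn_avoiding_def)

lemma no_AT_subset: "no_AT V \<Longrightarrow> U \<subseteq> V \<Longrightarrow> no_AT U"
  unfolding no_AT_def between_def by (meson conn_avoiding_mono)

lemma conn_avoiding_sym: "conn_avoiding V z x y \<Longrightarrow> conn_avoiding V z y x"
  by (auto simp: conn_avoiding_def conn_sym)

lemma conn_avoiding_trans:
  "conn_avoiding V z x w \<Longrightarrow> conn_avoiding V z w y \<Longrightarrow> conn_avoiding V z x y"
  by (auto simp: conn_avoiding_def intro: conn_trans)

lemma conn_avoidingD:
  assumes "conn_avoiding V z x y"
  shows "z \<in> V" "x \<in> far V z" "y \<in> far V z" "z \<in> far V x" "z \<in> far V y"
  using assms conn_in[of "far V z" x y] far_sym unfolding conn_avoiding_def by auto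

lemma between_sym: "between V x y z \<Longrightarrow> between V z y x"
  by (auto simp: between_def conn_avoiding_sym)

text \<open>A walk from \<open>s\<close> to \<open>c\<close> avoiding \<open>y\<close> either misses
  the closed neighbourhood of \<open>e\<close> or can be diverted to \<open>e\<close> there. As
  \<open>e\<close> is far from \<open>y\<close>, the diverted walk still avoids
  \<open>y\<close>.\<close>

lemma conn_avoiding_cut:
  assumes "conn_avoiding V y s c" and "e \<in> far V y"
  shows "conn_avoiding V e s c \<or> conn_avoiding V y s e"
proof -
  have e: "e \<in> V" and y: "y \<in> V"
    using assms by (auto simp: far_def conn_avoiding_def)
  have "conn (far V y) s c"
    using assms by (simp add: conn_avoiding_def)
  then have "conn (far V e) s c \<or> conn (far V y) s e"
  proof (induction rule: conn.induct)
    case (refl x)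
    show ?case
    proof (cases "x \<in> far V e")
      case False
      then have "x = e \<or> E x e"
        using refl sym by (auto simp: far_def)
      then show ?thesis
        using refl assms(2) by (metis conn.intros)
    qed (auto intro: conn.refl)
  next
    case (step x b w)
    show ?case
    proof (cases "w \<in> far V e")
      case False
      then have "w = e \<or> E w e"
        using step sym by (auto simp: far_def)
      then show ?thesis
        using step assms(2) by (metis conn.step)
    qed (use step in \<open>auto intro: conn.step\<close>)
  qed
  then show ?thesis
    using e y by (simp add: conn_avoiding_def)
qed

subsection \<open>Existence of an admissible vertex\<close>

lemma admissible_vertex_exists:
  assumes "finite V" and "V \<noteq> {}" and "no_AT V"
  shows "\<exists>a\<in>V. \<forall>x z. \<not> between V x a z"
  using assms
proof (induction "card V" arbitrary: V rule: less_induct)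
  case less
  show ?case
  proof (cases "\<exists>v\<in>V. far V v \<noteq> {}")
    case False
    then show ?thesis
      using less.prems by (metis between_def conn_avoidingD(1,2) empty_iff ex_in_conv)
  next
    case True
    \<comment> \<open>\<open>comp v x\<close> is the component of \<open>x\<close> after removing
      the closed neighbourhood of \<open>v\<close>; the pairs in \<open>I\<close> are those for
      which it is nonempty.\<close>
    define comp where "comp v x = {w. conn_avoiding V v x w}" for v x
    define I where "I = (SIGMA v:V. far V v)"
    have comp_sub: "comp v x \<subseteq> V" for v x
      unfolding comp_def using conn_avoidingD(3) by (fastforce simp: far_def)
    have "finite I"
      unfolding I_def using less.prems(1) by (auto simp: far_def)
    moreover have "I \<noteq> {}"
      using True by (auto simp: I_def)
    ultimately have "Max ((\<lambda>(v, x). card (comp v x)) ` I) \<in> (\<lambda>(v, x). card (comp v x)) ` I"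
      by (intro Max_in) auto
    then obtain v x where vx: "(v, x) \<in> I"
      and "card (comp v x) = Max ((\<lambda>(v, x). card (comp v x)) ` I)"
      by auto
    then have max: "card (comp v' x') \<le> card (comp v x)" if "(v', x') \<in> I" for v' x'
      using \<open>finite I\<close> that by (auto intro!: Max_ge rev_image_eqI[of "(v', x')"])
    define K where "K = comp v x"
    have "K \<subseteq> V"
      using comp_sub by (simp add: K_def)
    define A where "A = {a \<in> V. K \<subseteq> far V a}"
    have v: "v \<in> V" and x: "x \<in> far V v"
      using vx by (auto simp: I_def)
    have xK: "x \<in> K"
      using v x by (auto simp: K_def comp_def conn_avoiding_def intro: conn.refl)
    have K_conn: "conn K x w" if "w \<in> K" for w
      using conn_component[of "far V v" x w] that v
      by (simp add: K_def comp_def conn_avoiding_def)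
    have vA: "v \<in> A"
      using v conn_avoidingD(3) by (auto simp: A_def K_def comp_def)
    \<comment> \<open>\<open>K\<close> is connected and far from \<open>a\<close>, so it lies in a
      single component there; maximality of its size forces equality.\<close>
    have comp_A: "comp a x = K" if a: "a \<in> A" for a
    proof -
      have aV: "a \<in> V" and sub: "K \<subseteq> far V a"
        using a by (auto simp: A_def)
      have "K \<subseteq> comp a x"
        using K_conn conn_mono[OF _ sub] aV by (auto simp: comp_def conn_avoiding_def)
      moreover have "card (comp a x) \<le> card K"
        using max aV sub xK by (auto simp: K_def I_def)
      ultimately show ?thesis
        by (metis card_seteq comp_sub finite_subset less.prems(1))
    qed
    have K_no_A: "a \<notin> A" if "a \<in> K" for a
      using that by (auto simp: A_def far_def)
    have K_no_adj: "\<not> E a w" if "a \<in> A" "w \<in> K" for a w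
      using that by (auto simp: A_def far_def)
    \<comment> \<open>A vertex far from \<open>a\<close> but outside \<open>A\<close> lies in
      \<open>K\<close> or next to it, and \<open>K\<close> is a full component there.\<close>
    have trichotomy: "w \<in> K \<or> w \<in> A" if a: "a \<in> A" and w: "w \<in> far V a" for a w
    proof (rule ccontr)
      assume neg: "\<not> (w \<in> K \<or> w \<in> A)"
      then obtain k where k: "k \<in> K" "k = w \<or> E w k"
        using w \<open>K \<subseteq> V\<close> by (auto simp: A_def far_def)
      then have "E k w"
        using neg sym by auto
      moreover have "conn_avoiding V a x k"
        using comp_A[OF a] k by (auto simp: comp_def)
      ultimately have "w \<in> comp a x"
        using w by (auto simp: comp_def conn_avoiding_def intro: conn.step)
      then show False
        using neg comp_A[OF a] by simp
    qed
    have A_sub: "A \<subseteq> V"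
      by (auto simp: A_def)
    have closed: "w \<in> K" if "a \<in> A" "b \<in> K" "conn_avoiding V a b w" for a b w
      using that comp_A[of a] conn_avoiding_trans by (auto simp: comp_def)
    \<comment> \<open>By \<open>trichotomy\<close>, a walk avoiding \<open>z\<close> could leave
      \<open>A\<close> only into \<open>K\<close>, but no edge joins \<open>A\<close> to
      \<open>K\<close>.\<close>
    have local_conn: "conn_avoiding A z b w"
      if "z \<in> A" "b \<in> A" "conn_avoiding V z b w" for z b w
    proof -
      have "conn (far V z \<inter> A) b w"
      proof (rule conn_closed)
        show "conn (far V z) b w"
          using that by (simp add: conn_avoiding_def)
      next
        fix c d
        assume "c \<in> A" "E c d" "d \<in> far V z"
        then show "d \<in> A"
          using trichotomy[OF that(1)] K_no_adj by blast
      qed (rule that(2))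
      moreover have "far V z \<inter> A = far A z"
        using A_sub by (auto simp: far_def)
      ultimately show ?thesis
        using that(1) by (simp add: conn_avoiding_def)
    qed
    have "x \<in> V" "x \<notin> A"
      using x xK K_no_A by (auto simp: far_def)
    then have "card A < card V"
      using A_sub less.prems(1) by (metis psubsetI psubset_card_mono)
    moreover have "finite A" "A \<noteq> {}" "no_AT A"
      using A_sub less.prems vA finite_subset no_AT_subset by auto
    ultimately obtain a where a: "a \<in> A" and adm: "\<And>x z. \<not> between A x a z"
      using less.hyps by blast
    \<comment> \<open>If \<open>b\<close> and \<open>c\<close> are both in \<open>K\<close>, a walk
      through \<open>K\<close> completes an asteroidal triple. If exactly one is,
      \<open>closed\<close> would put \<open>a\<close> into \<open>K\<close>. If both are in
      \<open>A\<close>, betweenness already holds within \<open>A\<close>.\<close>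
    have "\<not> between V b a c" for b c
    proof
      assume bt: "between V b a c"
      then have "b \<in> far V a" "c \<in> far V a"
        by (auto simp: between_def dest: conn_avoidingD)
      then consider "b \<in> K" "c \<in> K" | "b \<in> K" "c \<in> A" | "b \<in> A" "c \<in> K" | "b \<in> A" "c \<in> A"
        using trichotomy[OF a] by blast
      then show False
      proof cases
        case 1
        then have "conn_avoiding V a b c"
          using comp_A[OF a] conn_avoiding_trans[OF conn_avoiding_sym[of V a x b], of c]
          by (auto simp: comp_def)
        then show ?thesis
          using bt less.prems(3) by (auto simp: no_AT_def)
      next
        case 2
        then show ?thesis
          using bt closed[of c b a] a K_no_A by (auto simp: between_def)
      next
        case 3
        then show ?thesis
          using bt closed[of b c a] a K_no_A conn_avoiding_sym[of V b a c] by (auto simp: between_def)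
      next
        case 4
        then show ?thesis
          using bt adm[of b c] local_conn a unfolding between_def by blast
      qed
    qed
    then show ?thesis
      using a A_sub by blast
  qed
qed

subsection \<open>The rank with respect to an admissible vertex\<close>

definition rank :: "'a set \<Rightarrow> 'a \<Rightarrow> 'a \<Rightarrow> nat" where
  "rank V s y = card {z. conn_avoiding V y s z}"

lemma finite_below: "finite V \<Longrightarrow> finite {z. conn_avoiding V y s z}"
  by (rule finite_subset[of _ V]) (auto dest: conn_avoidingD(3) simp: far_def)

text \<open>Otherwise cutting at \<open>e\<close> would yield a walk from \<open>s\<close> to
  \<open>e\<close> avoiding \<open>y\<close>, and then \<open>s\<close> would lie between
  \<open>y\<close> and \<open>e\<close>.\<close>

lemma conn_avoiding_admissible_trans:
  assumes adm: "\<And>x z. \<not> between V x s z"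
    and "conn_avoiding V e s y" and "conn_avoiding V y s f"
  shows "conn_avoiding V e s f"
proof -
  have "e \<in> far V y"
    using assms(2) conn_avoidingD by blast
  moreover have "\<not> conn_avoiding V y s e"
    using adm[of y e] assms(2) by (auto simp: between_def conn_avoiding_sym)
  ultimately show ?thesis
    using conn_avoiding_cut assms(3) by blast
qed

text \<open>By transitivity all vertices below \<open>y\<close> are below \<open>e\<close>; the
  inclusion is strict because \<open>y\<close> is below \<open>e\<close> but not below
  itself.\<close>

lemma rank_less:
  assumes "finite V" and adm: "\<And>x z. \<not> between V x s z" and "conn_avoiding V e s y"
  shows "rank V s y < rank V s e"
proof -
  have "y \<notin> {z. conn_avoiding V y s z}"
    using conn_avoidingD(3) by (fastforce simp: far_def)
  then have "{z. conn_avoiding V y s z} \<subset> {z. conn_avoiding V e s z}"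
    using conn_avoiding_admissible_trans[OF adm assms(3)] assms(3) by blast
  then show ?thesis
    unfolding rank_def by (rule psubset_card_mono[OF finite_below[OF assms(1)]])
qed

text \<open>For incomparable \<open>a\<close> and \<open>b\<close>, cutting turns a walk from
  \<open>s\<close> avoiding one of them into a walk with the same ends avoiding the other.\<close>

lemma rank_eq:
  assumes "a \<in> far V b" and "b \<in> V"
    and "\<not> conn_avoiding V a s b" and "\<not> conn_avoiding V b s a"
  shows "rank V s a = rank V s b"
proof -
  have "b \<in> far V a"
    using assms far_sym by blast
  then have "{z. conn_avoiding V a s z} = {z. conn_avoiding V b s z}"
    using conn_avoiding_cut assms by blast
  then show ?thesis
    by (simp add: rank_def)
qed

text \<open>Maximality means that \<open>y\<close> is below no member of \<open>D\<close>. If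
  \<open>x\<close> were below \<open>y\<close>, cut at \<open>z\<close>: either \<open>y\<close> is
  below \<open>z\<close>, or \<open>z\<close> is below \<open>y\<close> too and joining the walks at
  \<open>s\<close> completes an asteroidal triple. So \<open>x\<close> and \<open>y\<close> are
  incomparable. The vertex \<open>s\<close> is allowed as an end because it starts every prefix of
  the ordering.\<close>

lemma between_max_rank_aux:
  assumes "finite V" and "no_AT V" and adm: "\<And>x z. \<not> between V x s z"
    and max: "\<And>d. d \<in> D \<Longrightarrow> rank V s d \<le> rank V s y"
    and "x \<in> insert s D" and "z \<in> insert s D" and bt: "between V x y z"
  shows "x \<in> D \<and> rank V s x = rank V s y"
proof -
  have not_less: "\<not> conn_avoiding V d s y" if "d \<in> D" for d
    using rank_less[OF assms(1) adm] max[OF that] by (meson not_le)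
  have zxy: "conn_avoiding V z x y" and xyz: "conn_avoiding V x y z"
    using bt by (auto simp: between_def)
  have "x \<noteq> z"
    using zxy conn_avoidingD(2) by (fastforce simp: far_def)
  have x: "x \<in> D"
    using assms(5,6) not_less zxy \<open>x \<noteq> z\<close> by auto
  have "\<not> conn_avoiding V y s x"
  proof
    assume ysx: "conn_avoiding V y s x"
    have "z \<in> far V y"
      using zxy conn_avoidingD by blast
    then consider "conn_avoiding V z s x" | "conn_avoiding V y s z"
      using conn_avoiding_cut ysx by blast
    then show False
    proof cases
      case 1
      then have zsy: "conn_avoiding V z s y"
        using zxy conn_avoiding_trans by blast
      then have "z \<noteq> s"
        using conn_avoidingD(2) by (fastforce simp: far_def)
      then show ?thesis
        using zsy assms(6) not_less by auto
    next
      case 2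
      then have "conn_avoiding V y x z"
        using ysx conn_avoiding_sym conn_avoiding_trans by blast
      then show ?thesis
        using bt assms(2) by (auto simp: no_AT_def)
    qed
  qed
  moreover have "x \<in> far V y" "y \<in> V"
    using conn_avoidingD[OF xyz] by (auto simp: far_def)
  ultimately show ?thesis
    using x not_less[OF x] rank_eq[of x V y s] by auto
qed

lemma between_max_rank:
  assumes "finite V" and "no_AT V" and "\<And>x z. \<not> between V x s z"
    and "\<And>d. d \<in> D \<Longrightarrow> rank V s d \<le> rank V s y"
    and "x \<in> insert s D" and "z \<in> insert s D" and "between V x y z"
  shows "x \<in> D \<and> z \<in> D \<and> rank V s x = rank V s y \<and> rank V s z = rank V s y"
  using between_max_rank_aux[OF assms]
    between_max_rank_aux[OF assms(1-4) assms(6,5) between_sym[OF assms(7)]] by blast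

section \<open>Extreme vertices of vertex sets and the resulting ordering\<close>

text \<open>Betweenness refers to all of \<open>V\<close>, so the induction is on \<open>V\<close>
  with \<open>M\<close> arbitrary: it passes to the top rank class \<open>M'\<close> inside
  \<open>V - {r}\<close>.\<close>

lemma extreme_vertex_exists:
  assumes "finite V" and "no_AT V" and "M \<subseteq> V" and "M \<noteq> {}"
  shows "\<exists>y\<in>M. \<forall>x\<in>M. \<forall>z\<in>M. \<not> between V x y z"
  using assms
proof (induction "card V" arbitrary: V M rule: less_induct)
  case less
  have "V \<noteq> {}"
    using less.prems by auto
  then obtain r where r: "r \<in> V" and adm: "\<And>x z. \<not> between V x r z"
    using admissible_vertex_exists[OF less.prems(1) _ less.prems(2)] by blast
  show ?case
  proof (cases "r \<in> M")
    case True
    then show ?thesis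
      using adm by blast
  next
    case False
    have fin: "finite M"
      using less.prems finite_subset by blast
    define m where "m = Max (rank V r ` M)"
    define M' where "M' = {y \<in> M. rank V r y = m}"
    have max: "rank V r d \<le> m" if "d \<in> M" for d
      using that fin by (auto simp: m_def)
    have "m \<in> rank V r ` M"
      unfolding m_def using fin less.prems(4) by (intro Max_in) auto
    then have M'_ne: "M' \<noteq> {}"
      by (auto simp: M'_def)
    have M'_sub: "M' \<subseteq> V - {r}"
      using less.prems False by (auto simp: M'_def)
    have "card (V - {r}) < card V"
      using r less.prems(1) by (metis card_Diff1_less)
    then obtain y where y: "y \<in> M'"
      and ext: "\<And>x z. x \<in> M' \<Longrightarrow> z \<in> M' \<Longrightarrow> \<not> between (V - {r}) x y z"
      using less.hyps[of "V - {r}" M'] less.prems M'_ne M'_sub no_AT_subset[of V "V - {r}"]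
      by blast
    \<comment> \<open>A walk from \<open>a\<close> to \<open>r\<close> avoiding \<open>c\<close>
      would place \<open>a\<close> strictly below \<open>c\<close>, yet both have rank
      \<open>m\<close>. So the component of \<open>a\<close> misses \<open>r\<close>.\<close>
    have delete: "conn_avoiding (V - {r}) c a b"
      if "conn_avoiding V c a b" "a \<in> M'" "c \<in> M'" for a b c
    proof -
      have "\<not> conn_avoiding V c a r"
        using rank_less[OF less.prems(1) adm, of c a] that conn_avoiding_sym
        by (auto simp: M'_def)
      then have "conn (far V c - {r}) a b"
        using that conn_delete by (auto simp: conn_avoiding_def)
      moreover have "far V c - {r} = far (V - {r}) c"
        by (auto simp: far_def)
      ultimately show ?thesis
        using that M'_sub by (auto simp: conn_avoiding_def)
    qed
    have "\<not> between V x y z" if xz: "x \<in> M" "z \<in> M" for x z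
    proof
      assume bt: "between V x y z"
      have "x \<in> M \<and> z \<in> M \<and> rank V r x = rank V r y \<and> rank V r z = rank V r y"
        by (rule between_max_rank[OF less.prems(1,2) adm _ _ _ bt])
          (use xz y max in \<open>auto simp: M'_def\<close>)
      then have "x \<in> M'" "z \<in> M'"
        using y by (auto simp: M'_def)
      then show False
        using bt ext delete y unfolding between_def by blast
    qed
    then show ?thesis
      using y by (auto simp: M'_def)
  qed
qed

text \<open>The list is built from its end: the last vertex is an extreme member of the top rank
  class of \<open>D\<close>, the set of vertices still to be placed after \<open>s\<close>. The two
  prefix conditions later give the AT-free order and the dominating pairs.\<close>

lemma ordering_exists:
  assumes "finite V" and "no_AT V" and "\<And>x z. \<not> between V x s z" and "s \<in> V"
    and "D \<subseteq> V - {s}"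
  shows "\<exists>\<tau>. distinct \<tau> \<and> \<tau> \<noteq> [] \<and> hd \<tau> = s \<and> set \<tau> = insert s D \<and>
    (\<forall>xs y ys. \<tau> = xs @ y # ys \<longrightarrow>
      (\<forall>x\<in>set xs. \<forall>z\<in>set xs. \<not> between V x y z) \<and> (\<forall>x\<in>set xs. \<not> conn_avoiding V x s y))"
  using assms(5)
proof (induction "card D" arbitrary: D rule: less_induct)
  case less
  show ?case
  proof (cases "D = {}")
    case True
    then show ?thesis
      by (intro exI[of _ "[s]"]) (auto simp: Cons_eq_append_conv)
  next
    case False
    have fin: "finite D"
      using less.prems assms(1) finite_subset by blast
    define m where "m = Max (rank V s ` D)"
    define M where "M = {y \<in> D. rank V s y = m}"
    have max: "rank V s d \<le> m" if "d \<in> D" for d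
      using that fin by (auto simp: m_def)
    have "m \<in> rank V s ` D"
      unfolding m_def using fin False by (intro Max_in) auto
    then have "M \<noteq> {}"
      by (auto simp: M_def)
    moreover have "M \<subseteq> V"
      using less.prems by (auto simp: M_def)
    ultimately obtain y where y: "y \<in> M"
      and ext: "\<And>x z. x \<in> M \<Longrightarrow> z \<in> M \<Longrightarrow> \<not> between V x y z"
      using extreme_vertex_exists[OF assms(1,2), of M] by blast
    have yD: "y \<in> D"
      using y by (simp add: M_def)
    \<comment> \<open>Such \<open>x\<close> and \<open>z\<close> would have maximum rank as well,
      hence lie in \<open>M\<close>, where \<open>y\<close> is extreme.\<close>
    have nb: "\<not> between V x y z" if xz: "x \<in> insert s D" "z \<in> insert s D" for x z
    proof
      assume bt: "between V x y z"
      have "x \<in> D \<and> z \<in> D \<and> rank V s x = rank V s y \<and> rank V s z = rank V s y"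
        by (rule between_max_rank[OF assms(1-3) _ xz bt]) (use y max in \<open>auto simp: M_def\<close>)
      then show False
        using bt ext y by (auto simp: M_def)
    qed
    have nl: "\<not> conn_avoiding V x s y" if x: "x \<in> insert s D" for x
    proof (cases "x = s")
      case True
      then show ?thesis
        using conn_avoidingD(2)[of V s s y] by (auto simp: far_def)
    next
      case False
      then show ?thesis
        using x rank_less[OF assms(1,3), of x y] max[of x] y by (auto simp: M_def)
    qed
    have "card (D - {y}) < card D"
      using yD fin by (metis card_Diff1_less)
    then obtain \<tau> where \<tau>: "distinct \<tau>" "\<tau> \<noteq> []" "hd \<tau> = s" "set \<tau> = insert s (D - {y})"
      "\<And>xs y ys. \<tau> = xs @ y # ys \<Longrightarrow>
        (\<forall>x\<in>set xs. \<forall>z\<in>set xs. \<not> between V x y z) \<and> (\<forall>x\<in>set xs. \<not> conn_avoiding V x s y)"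
      using less.hyps[of "D - {y}"] less.prems by blast
    have "y \<noteq> s"
      using yD less.prems by auto
    have split: "(\<forall>x\<in>set xs. \<forall>z\<in>set xs. \<not> between V x v z) \<and>
        (\<forall>x\<in>set xs. \<not> conn_avoiding V x s v)" if eq: "\<tau> @ [y] = xs @ v # ys" for xs v ys
    proof (cases ys rule: rev_cases)
      case Nil
      then have "xs = \<tau>" "v = y"
        using eq by auto
      then show ?thesis
        using nb nl \<tau>(4) by auto
    next
      case (snoc ys' w)
      then have "\<tau> = xs @ v # ys'"
        using eq by (metis append_Cons append_assoc butlast_snoc)
      then show ?thesis
        using \<tau>(5) by blast
    qed
    show ?thesis
      by (rule exI[of _ "\<tau> @ [y]"]) (use \<tau>(1-4) \<open>y \<noteq> s\<close> yD split in \<open>auto simp: hd_append\<close>)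
  qed
qed

subsection \<open>Chordless paths\<close>

lemma conn_imp_walk:
  "conn U x y \<Longrightarrow> \<exists>p. p \<noteq> [] \<and> hd p = x \<and> last p = y \<and> set p \<subseteq> U \<and> successively E p"
proof (induction rule: conn.induct)
  case (refl x)
  then show ?case
    by (intro exI[of _ "[x]"]) auto
next
  case (step x y z)
  then obtain p where "p \<noteq> []" "hd p = x" "last p = y" "set p \<subseteq> U" "successively E p"
    by blast
  then show ?case
    using step.hyps by (intro exI[of _ "p @ [z]"]) (auto simp: successively_append_iff)
qed

lemma walk_imp_conn:
  "successively E p \<Longrightarrow> p \<noteq> [] \<Longrightarrow> set p \<subseteq> U \<Longrightarrow> conn U (hd p) (last p)"
proof (induction p rule: rev_induct)
  case (snoc z p)
  then show ?case
    by (cases "p = []") (auto simp: successively_append_iff intro: conn.intros)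
qed simp

text \<open>A shortest walk works, since a repeated vertex or a chord would allow a
  shortcut.\<close>

lemma conn_imp_chordless_path:
  assumes "conn U x y"
  shows "\<exists>p. p \<noteq> [] \<and> hd p = x \<and> last p = y \<and> set p \<subseteq> U \<and> successively E p \<and> distinct p \<and>
    (\<forall>i j. Suc i < j \<and> j < length p \<longrightarrow> \<not> E (p ! i) (p ! j))"
proof -
  define W where "W p \<longleftrightarrow> p \<noteq> [] \<and> hd p = x \<and> last p = y \<and> set p \<subseteq> U \<and> successively E p" for p
  obtain p where p: "W p" and min: "\<And>q. W q \<Longrightarrow> length p \<le> length q"
    using conn_imp_walk[OF assms] ex_has_least_nat[of W _ length] unfolding W_def by metis
  have shortcut: "\<not> W (take i p @ drop j p)" if "i < j" "j < length p" for i j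
    using min[of "take i p @ drop j p"] that by auto
  \<comment> \<open>The entries at positions \<open>i\<close> to \<open>j - 1\<close> are cut out.
    For \<open>i = 0\<close> the entry at \<open>j\<close> becomes the head, so it must be
    \<open>x\<close>.\<close>
  have walk: "W (take i p @ drop j p)"
    if ij: "i < j" "j < length p" and "i = 0 \<Longrightarrow> p ! j = x" "i > 0 \<Longrightarrow> E (p ! (i - 1)) (p ! j)" for i j
  proof -
    have "successively E (take i p)" "successively E (drop j p)"
      using p append_take_drop_id[of _ p] unfolding W_def by (metis successively_append_iff)+
    moreover have "last (take i p) = p ! (i - 1)" if "i > 0"
      using that ij by (subst last_conv_nth) auto
    moreover have "hd (take i p) = x" if "i > 0"
      using that p by (auto simp: W_def hd_take)
    moreover have "set (take i p) \<subseteq> U" "set (drop j p) \<subseteq> U"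
      using p set_take_subset set_drop_subset unfolding W_def by fastforce+
    ultimately show ?thesis
      using that p unfolding W_def
      by (cases "i = 0") (auto simp: successively_append_iff hd_drop_conv_nth hd_append)
  qed
  have "p ! i \<noteq> p ! j" if "i < j" "j < length p" for i j
  proof
    assume eq: "p ! i = p ! j"
    have "p ! 0 = x"
      using p by (auto simp: W_def hd_conv_nth)
    moreover have "E (p ! (i - 1)) (p ! i)" if "i > 0"
      using p that \<open>i < j\<close> \<open>j < length p\<close> unfolding W_def
      by (metis One_nat_def Suc_pred less_trans successively_nth)
    ultimately show False
      using walk[OF that] shortcut[OF that] eq by metis
  qed
  then have "distinct p"
    by (metis distinct_conv_nth linorder_neqE_nat)
  \<comment> \<open>Here \<open>walk\<close> is used with \<open>Suc i\<close> as its first index,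
    so that \<open>p ! i\<close> is kept and the chord bridges the gap.\<close>
  moreover have "\<not> E (p ! i) (p ! j)" if "Suc i < j" "j < length p" for i j
    using walk[OF that] shortcut[OF that] by auto
  ultimately show ?thesis
    using p unfolding W_def by blast
qed

end

section \<open>Digraphs\<close>

lemma vwalk_arcs_subset_iff:
  "set (vwalk_arcs p) \<subseteq> arcs_ends G \<longleftrightarrow> successively (\<lambda>u v. u \<rightarrow>\<^bsub>G\<^esub> v) p"
  by (induction p rule: vwalk_arcs.induct) auto

lemma vpath_successively_iff:
  "vpath p G \<longleftrightarrow> set p \<subseteq> verts G \<and> successively (\<lambda>u v. u \<rightarrow>\<^bsub>G\<^esub> v) p \<and> p \<noteq> [] \<and> distinct p"
  by (auto simp: vpath_def vwalk_def vwalk_arcs_subset_iff)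

context graph
begin

sublocale adj: symmetric_adjacency "\<lambda>u v. u \<rightarrow>\<^bsub>G\<^esub> v"
  using sym_arcs by unfold_locales (auto simp: symmetric_def dest: symD)

text \<open>\<open>avoids\<close> forbids only neighbours of \<open>z\<close>. Since the path does
  not start in \<open>z\<close>, an occurrence of \<open>z\<close> would have a predecessor, which
  is such a neighbour.\<close>

lemma path_avoids_imp_conn_avoiding:
  assumes p: "path_betw G x p y" and "avoids G p z" and "z \<in> verts G" and "x \<noteq> z"
  shows "adj.conn_avoiding (verts G) z x y"
proof -
  have walk: "successively (\<lambda>u v. u \<rightarrow>\<^bsub>G\<^esub> v) p" "p \<noteq> []" "set p \<subseteq> verts G" "hd p = x" "last p = y"
    using p by (auto simp: path_betw_def vpath_successively_iff)
  have "z \<notin> set p"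
  proof
    assume "z \<in> set p"
    then obtain as bs where eq: "p = as @ z # bs"
      by (meson split_list)
    then have "as \<noteq> []"
      using walk(4) assms(4) by auto
    then have "last as \<rightarrow>\<^bsub>G\<^esub> z" "last as \<in> set p"
      using walk(1) eq by (auto simp: successively_append_iff)
    then show False
      using assms(2) adj.sym by (auto simp: avoids_def)
  qed
  then have "set p \<subseteq> adj.far (verts G) z"
    using walk(3) assms(2) by (auto simp: adj.far_def avoids_def)
  then show ?thesis
    using adj.walk_imp_conn[OF walk(1,2)] walk(4,5) assms(3) by (simp add: adj.conn_avoiding_def)
qed

lemma conn_avoiding_imp_chordless_path:
  assumes "adj.conn_avoiding (verts G) z x y"
  shows "\<exists>p. path_betw G x p y \<and> chordless G p \<and> avoids G p z"
proof -
  have "adj.conn (adj.far (verts G) z) x y"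
    using assms by (simp add: adj.conn_avoiding_def)
  from adj.conn_imp_chordless_path[OF this] show ?thesis
    unfolding path_betw_def chordless_def avoids_def vpath_successively_iff adj.far_def by blast
qed

text \<open>Requiring chordless paths changes nothing, as connectedness always yields one;
  distinctness comes from \<open>far\<close>.\<close>

lemma dom_betweenness_iff:
  "(x, y, z) \<in> dom_betweenness G \<longleftrightarrow> adj.between (verts G) x y z"
proof
  assume "(x, y, z) \<in> dom_betweenness G"
  then show "adj.between (verts G) x y z"
    by (auto simp: dom_betweenness_def adj.between_def intro!: path_avoids_imp_conn_avoiding)
next
  assume "adj.between (verts G) x y z"
  then have zxy: "adj.conn_avoiding (verts G) z x y" and xyz: "adj.conn_avoiding (verts G) x y z"
    by (auto simp: adj.between_def)
  show "(x, y, z) \<in> dom_betweenness G"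
    using adj.conn_avoidingD[OF zxy] adj.conn_avoidingD[OF xyz]
      conn_avoiding_imp_chordless_path[OF zxy] conn_avoiding_imp_chordless_path[OF xyz]
    by (auto simp: dom_betweenness_def adj.far_def)
qed

text \<open>Membership in \<open>far\<close> supplies independence and distinctness, and reversing
  the three paths covers all ordered pairs.\<close>

lemma AT_free_imp_no_AT:
  assumes "AT_free G"
  shows "adj.no_AT (verts G)"
  unfolding adj.no_AT_def
proof (intro allI impI notI)
  fix x y z
  assume "adj.between (verts G) x y z" and yxz: "adj.conn_avoiding (verts G) y x z"
  then have zxy: "adj.conn_avoiding (verts G) z x y" and xyz: "adj.conn_avoiding (verts G) x y z"
    by (auto simp: adj.between_def)
  note far = adj.conn_avoidingD[OF zxy] adj.conn_avoidingD[OF xyz] adj.conn_avoidingD[OF yxz]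
  have path: "\<exists>p. path_betw G a p b \<and> avoids G p c"
    if "adj.conn_avoiding (verts G) c a b" for a b c
    using conn_avoiding_imp_chordless_path[OF that] by blast
  have "independent_set G {x, y, z}"
    using far by (auto simp: independent_set_def adj.far_def dest: adj_not_same)
  moreover have "card {x, y, z} = 3"
    using far by (auto simp: adj.far_def)
  moreover have "\<exists>p. path_betw G a p b \<and> avoids G p c"
    if "a \<in> {x, y, z}" "b \<in> {x, y, z}" "c \<in> {x, y, z}" "a \<noteq> b \<and> a \<noteq> c \<and> b \<noteq> c" for a b c
    by (rule path) (use that zxy xyz yxz adj.conn_avoiding_sym in auto)
  ultimately have "asteroidal_triple G {x, y, z}"
    unfolding asteroidal_triple_def by blast
  then show False
    using assms by (auto simp: AT_free_def)
qed

end

section \<open>Both order properties of the constructed list\<close>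

theorem theorem4:
  fixes G :: "('a,'b) pre_digraph" and s :: 'a
  assumes "graph G" and "connected G" and "AT_free G" and "admissible G s"
  shows "\<exists>\<tau>. vertex_ordering G \<tau> \<and> hd \<tau> = s \<and>
    AT_free_order G \<tau> \<and> monotone_dominating_pair_order G \<tau>"
proof -
  interpret graph G
    by (rule assms(1))
  have s: "s \<in> verts G" and adm: "\<And>x z. \<not> adj.between (verts G) x s z"
    using assms(4) by (auto simp: admissible_def dom_betweenness_iff)
  \<comment> \<open>The ordering lemma is instantiated with
    \<open>D = verts G - {s}\<close>.\<close>
  obtain \<tau> where \<tau>: "distinct \<tau>" "\<tau> \<noteq> []" "hd \<tau> = s" "set \<tau> = verts G"
    and nb: "\<And>xs y ys x z. \<tau> = xs @ y # ys \<Longrightarrow> x \<in> set xs \<Longrightarrow> z \<in> set xs \<Longrightarrow>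
      \<not> adj.between (verts G) x y z"
    and nl: "\<And>xs y ys x. \<tau> = xs @ y # ys \<Longrightarrow> x \<in> set xs \<Longrightarrow>
      \<not> adj.conn_avoiding (verts G) x s y"
    using adj.ordering_exists[OF finite_verts AT_free_imp_no_AT[OF assms(3)] adm s subset_refl] s
    by (metis insert_Diff)
  have ord: "vertex_ordering G \<tau>"
    using \<tau> by (simp add: vertex_ordering_def)
  have prec: "precedes \<tau> y x" if eq: "\<tau> = xs @ y # ys" and x: "x \<in> set ys" for xs y ys x
  proof -
    obtain j where "j < length ys" "ys ! j = x"
      using x by (meson in_set_conv_nth)
    then show ?thesis
      unfolding precedes_def eq
      by (intro exI[of _ "length xs"] exI[of _ "length xs + Suc j"]) (auto simp: nth_append)
  qed
  \<comment> \<open>By \<open>nb\<close>, the vertices \<open>x\<close> and \<open>z\<close> cannot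
    both come before \<open>y\<close>.\<close>
  have "precedes \<tau> y x \<or> precedes \<tau> y z" if dom: "(x, y, z) \<in> dom_betweenness G" for x y z
  proof -
    have xyz: "x \<in> set \<tau>" "y \<in> set \<tau>" "z \<in> set \<tau>" "x \<noteq> y" "z \<noteq> y"
      using dom \<tau>(4) by (auto simp: dom_betweenness_def)
    obtain xs ys where eq: "\<tau> = xs @ y # ys"
      using xyz(2) by (meson split_list)
    then have "x \<in> set ys \<or> z \<in> set ys"
      using nb[OF eq, of x z] dom xyz by (auto simp: dom_betweenness_iff)
    then show ?thesis
      using prec[OF eq] by blast
  qed
  then have AT: "AT_free_order G \<tau>"
    using ord by (auto simp: AT_free_order_def)
  have "dominating_pair (G \<restriction> set (take (Suc i) \<tau>)) (\<tau> ! 0) (\<tau> ! i)" if i: "i < length \<tau>" for i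
  proof -
    define P where "P = set (take (Suc i) \<tau>)"
    define xs where "xs = take i \<tau>"
    define y where "y = \<tau> ! i"
    have eq: "\<tau> = xs @ y # drop (Suc i) \<tau>"
      using i by (simp add: xs_def y_def id_take_nth_drop)
    have P: "P = insert y (set xs)"
      using i by (auto simp: P_def xs_def y_def take_Suc_conv_app_nth)
    have P_sub: "P \<subseteq> verts G"
      using \<tau>(4) set_take_subset by (fastforce simp: P_def)
    have s0: "\<tau> ! 0 = s"
      using \<tau> by (metis hd_conv_nth)
    then have sP: "s \<in> P"
      using \<tau>(2,3) by (cases \<tau>) (auto simp: P_def)
    have "dominating_set (G \<restriction> P) (set p)" if p: "path_betw (G \<restriction> P) s p y" for p
      unfolding dominating_set_def
    proof (intro conjI ballI)
      show p_sub: "set p \<subseteq> verts (G \<restriction> P)"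
        using p by (auto simp: path_betw_def vpath_successively_iff)
      fix v
      assume "v \<in> verts (G \<restriction> P)"
      then have v: "v \<in> P"
        by simp
      show "v \<in> set p \<or> (\<exists>u\<in>set p. u \<rightarrow>\<^bsub>G \<restriction> P\<^esub> v)"
      \<comment> \<open>A missed \<open>v\<close> differs from the ends \<open>s\<close> and
        \<open>y\<close> of \<open>p\<close>, and \<open>p\<close> avoids it also in
        \<open>G\<close>. Hence \<open>y\<close> is below \<open>v\<close> although \<open>v\<close>
        comes earlier, contradicting \<open>nl\<close>.\<close>
      proof (rule ccontr)
        assume neg: "\<not> (v \<in> set p \<or> (\<exists>u\<in>set p. u \<rightarrow>\<^bsub>G \<restriction> P\<^esub> v))"
        have ends: "p \<noteq> []" "hd p = s" "last p = y"
          using p by (auto simp: path_betw_def vpath_successively_iff)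
        then have "v \<noteq> y" "v \<noteq> s"
          using neg last_in_set hd_in_set by metis+
        have "successively (\<lambda>u v. u \<rightarrow>\<^bsub>G\<^esub> v) p"
          using p by (auto simp: path_betw_def vpath_successively_iff
            elim!: successively_mono dest: dominates_induce_subgraphD)
        then have "path_betw G s p y"
          using p p_sub P_sub by (auto simp: path_betw_def vpath_successively_iff)
        moreover have "u \<rightarrow>\<^bsub>G \<restriction> P\<^esub> v" if "u \<in> set p" "v \<rightarrow>\<^bsub>G\<^esub> u" for u
          using adj.sym[OF that(2)] that(1) v p_sub by (auto simp: arcs_ends_conv)
        then have "avoids G p v"
          using neg by (auto simp: avoids_def)
        ultimately have "adj.conn_avoiding (verts G) v s y"
          using path_avoids_imp_conn_avoiding v P_sub \<open>v \<noteq> s\<close> by blast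
        moreover have "v \<in> set xs"
          using v P \<open>v \<noteq> y\<close> by auto
        ultimately show False
          using nl[OF eq] by blast
      qed
    qed
    then show ?thesis
      using s0 sP P unfolding dominating_pair_def P_def[symmetric] y_def[symmetric] by auto
  qed
  then have "monotone_dominating_pair_order G \<tau>"
    using ord by (auto simp: monotone_dominating_pair_order_def)
  then show ?thesis
    using ord AT \<tau>(3) by blast
qed

end
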